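(* For all integers $r\geq 1$ and $n\geq 1$, $$\sigma_r\mathrm{mex}(n)=\sum_{m\geq 0}p\big(n-t_r(m)\big)$$ and $$\overline{\sigma}_r\mathrm{mex}(n)=\sum_{m\geq 0}(-1)^m(2m+1)\,p\big(n-t_r(m)\big).$$
   Context: For an integer $n\ge 0$, $p(n)$ denotes the number of partitions of $n$, with $p(0)=1$ and $p(n)=0$ for $n<0$; $\mathcal{P}(n)$ is the set of all partitions of $n$. For an integer $r\geq 1$ and a partition $\pi$, $r\text{-}\mathrm{mex}(\pi)$ (the least $r$-gap) is the least positive integer that does not occur at least $r$ times as a part of $\pi$. Define $$\sigma_r\mathrm{mex}(n):=\sum_{\pi\in\mathcal{P}(n)}r\text{-}\mathrm{mex}(\pi),\qquad \overline{\sigma}_r\mathrm{mex}(n):=\sum_{\pi\in\mathcal{P}(n)}(-1)^{r\text{-}\mathrm{mex}(\pi)-1}\,r\text{-}\mathrm{mex}(\pi).$$ For $m\geq 0$, $t_r(m):=r\cdot\frac{m(m+1)}{2}$. All sums are finite (only finitely many nonzero terms). *)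

theory Defs
  imports Main "HOL-Library.Multiset" "HOL-Library.Groups_Big_Fun"
begin

definition partitions :: "nat \<Rightarrow> nat multiset set" where
  "partitions n = {\<pi>. 0 \<notin># \<pi> \<and> \<Sum>\<^sub># \<pi> = n}"

definition num_partitions :: "int \<Rightarrow> nat" where
  "num_partitions k = (if k < 0 then 0 else card (partitions (nat k)))"

definition rmex :: "nat \<Rightarrow> nat multiset \<Rightarrow> nat" where
  "rmex r \<pi> = (LEAST k. 0 < k \<and> \<not> r \<le> count \<pi> k)"

definition sigma_mex :: "nat \<Rightarrow> nat \<Rightarrow> nat" where
  "sigma_mex r n = (\<Sum>\<pi>\<in>partitions n. rmex r \<pi>)"

definition sigma_bar_mex :: "nat \<Rightarrow> nat \<Rightarrow> int" where
  "sigma_bar_mex r n = (\<Sum>\<pi>\<in>partitions n. (- 1) ^ (rmex r \<pi> - 1) * int (rmex r \<pi>))"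

(* The division is exact, m * (m + 1) being even. *)
definition t :: "nat \<Rightarrow> nat \<Rightarrow> nat" where
  "t r m = r * (m * (m + 1) div 2)"

(* The four facts below confirm that no default value intervenes: sum and card
   run over finite sets, Sum_any has finite support, and the LEAST in rmex is
   attained (which needs r > 0). *)

lemma finite_partitions: "finite (partitions n)"
proof -
  have size: "0 \<notin># \<pi> \<Longrightarrow> size \<pi> \<le> \<Sum>\<^sub># \<pi>" for \<pi> :: "nat multiset"
    by (induction \<pi>) auto
  have part: "x \<in># \<pi> \<Longrightarrow> x \<le> \<Sum>\<^sub># \<pi>" for x :: nat and \<pi>
    by (induction \<pi>) auto
  have "partitions n \<subseteq> mset ` {xs. set xs \<subseteq> {..n} \<and> length xs \<le> n}"
  proof
    fix \<pi> assume \<pi>: "\<pi> \<in> partitions n"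
    obtain xs where xs: "mset xs = \<pi>" using ex_mset by blast
    have "set xs \<subseteq> {..n}" using part \<pi> xs by (auto simp: partitions_def)
    moreover have "length xs \<le> n" using size[of \<pi>] \<pi> xs by (auto simp: partitions_def)
    ultimately show "\<pi> \<in> mset ` {xs. set xs \<subseteq> {..n} \<and> length xs \<le> n}" using xs by blast
  qed
  then show ?thesis
    by (rule finite_subset) (rule finite_imageI[OF finite_lists_length_le[OF finite_atMost]])
qed

lemma rmex_exists:
  fixes \<pi> :: "nat multiset"
  assumes "0 < r"
  shows "\<exists>k. 0 < k \<and> \<not> r \<le> count \<pi> k"
proof -
  have "finite (insert 0 (set_mset \<pi>))" by simp
  from ex_new_if_finite[OF infinite_UNIV_nat this]
  obtain k where "k \<notin> insert 0 (set_mset \<pi>)" ..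
  then have "0 < k \<and> count \<pi> k = 0" by (simp add: count_eq_zero_iff)
  then have "0 < k \<and> \<not> r \<le> count \<pi> k" using assms by simp
  then show ?thesis ..
qed

lemma finite_support:
  assumes "0 < r"
  shows "finite {m. num_partitions (int n - int (t r m)) \<noteq> 0}"
proof -
  have "m \<le> n" if "num_partitions (int n - int (t r m)) \<noteq> 0" for m
  proof -
    have "t r m \<le> n" using that by (auto simp: num_partitions_def split: if_splits)
    moreover have "m * 2 \<le> m * (m + 1)" by (cases m) auto
    then have "m \<le> m * (m + 1) div 2" by (metis div_le_mono nonzero_mult_div_cancel_right zero_neq_numeral)
    moreover have "m * (m + 1) div 2 \<le> t r m" unfolding t_def using assms by simp
    ultimately show ?thesis by simp
  qed
  then show ?thesis by (intro finite_subset[OF _ finite_atMost[of n]]) auto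
qed

lemma finite_support_signed:
  assumes "0 < r"
  shows "finite {m. (- 1) ^ m * (2 * int m + 1) * int (num_partitions (int n - int (t r m))) \<noteq> 0}"
proof (rule finite_subset[OF _ finite_support[OF assms, of n]], rule Collect_mono, rule impI)
  fix m
  assume "(- 1) ^ m * (2 * int m + 1) * int (num_partitions (int n - int (t r m))) \<noteq> 0"
  then have "int (num_partitions (int n - int (t r m))) \<noteq> 0" by (metis mult_zero_right)
  then show "num_partitions (int n - int (t r m)) \<noteq> 0" by (metis of_nat_0)
qed

end

theory Submission imports Defs
begin

text \<open>
  The \<open>r\<close>-mex of \<open>\<pi>\<close> exceeds \<open>m\<close> exactly when \<open>\<pi>\<close> contains the staircase with \<open>r\<close> copies of each
  of \<open>1, \<dots>, m\<close>. Removing this staircase, of weight \<open>t r m\<close>, shows that \<open>p (n - t r m)\<close> counts the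
  partitions of \<open>n\<close> with \<open>r\<close>-mex larger than \<open>m\<close>. Both identities follow by exchanging sums, after
  writing the weight of an \<open>r\<close>-mex \<open>k\<close> as a sum over \<open>m < k\<close>: \<open>k\<close> is the sum of \<open>1\<close>, and
  \<open>(-1)^(k-1) * k\<close> is the sum of \<open>(-1)^m * (2 * m + 1)\<close>.
\<close>

definition staircase :: "nat \<Rightarrow> nat \<Rightarrow> nat multiset" where
  "staircase r m = (\<Sum>k=1..m. replicate_mset r k)"

lemma count_staircase: "count (staircase r m) k = (if 1 \<le> k \<and> k \<le> m then r else 0)"
  by (simp add: staircase_def count_sum)

lemma sum_mset_staircase: "\<Sum>\<^sub># (staircase r m) = t r m"
proof (induction m)
  case 0
  then show ?case by (simp add: staircase_def t_def)
next
  case (Suc m)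
  have "Suc m * (Suc m + 1) div 2 = m * (m + 1) div 2 + Suc m"
    by simp
  then show ?case
    using Suc by (simp add: staircase_def t_def distrib_left)
qed

lemma zero_notin_staircase: "0 \<notin># staircase r m"
  by (simp add: count_staircase flip: count_eq_zero_iff)

text \<open>Every positive \<open>k\<close> below the least gap occurs at least \<open>r\<close>
  times, while a staircase reaching the gap would force \<open>r\<close> copies of it. Positivity of
  \<open>r\<close> ensures that a gap exists.\<close>

lemma staircase_subseteq_iff:
  assumes "0 < r"
  shows "staircase r m \<subseteq># \<pi> \<longleftrightarrow> m < rmex r \<pi>"
proof
  have gap: "0 < rmex r \<pi>" "\<not> r \<le> count \<pi> (rmex r \<pi>)"
    using LeastI_ex[OF rmex_exists[OF assms, of \<pi>]] by (simp_all add: rmex_def)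
  assume sub: "staircase r m \<subseteq># \<pi>"
  show "m < rmex r \<pi>"
  proof (rule ccontr)
    assume "\<not> m < rmex r \<pi>"
    then have "count (staircase r m) (rmex r \<pi>) = r"
      using gap by (simp add: count_staircase)
    then show False
      using mset_subset_eq_count[OF sub, of "rmex r \<pi>"] gap by simp
  qed
next
  assume "m < rmex r \<pi>"
  then have "r \<le> count \<pi> k" if "1 \<le> k" "k \<le> m" for k
    using not_less_Least[of k "\<lambda>k. 0 < k \<and> \<not> r \<le> count \<pi> k"] that by (auto simp: rmex_def)
  then show "staircase r m \<subseteq># \<pi>"
    by (auto simp: subseteq_mset_def count_staircase)
qed

lemma num_partitions_eq_card_rmex:
  assumes "0 < r"
  shows "num_partitions (int n - int (t r m)) = card {\<pi> \<in> partitions n. m < rmex r \<pi>}"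
proof (cases "t r m \<le> n")
  case True
  let ?s = "staircase r m"
  have "{\<pi> \<in> partitions n. ?s \<subseteq># \<pi>} = (\<lambda>\<pi>. \<pi> + ?s) ` partitions (n - t r m)"
  proof (intro equalityI subsetI)
    fix \<pi> assume "\<pi> \<in> {\<pi> \<in> partitions n. ?s \<subseteq># \<pi>}"
    then have \<pi>: "\<pi> \<in> partitions n" "\<pi> = (\<pi> - ?s) + ?s" by auto
    have "\<Sum>\<^sub># \<pi> = \<Sum>\<^sub># (\<pi> - ?s) + t r m"
      by (subst \<pi>(2)) (simp only: sum_mset.union sum_mset_staircase)
    with \<pi>(1) have "\<pi> - ?s \<in> partitions (n - t r m)"
      by (auto simp: partitions_def dest: in_diffD)
    with \<pi>(2) show "\<pi> \<in> (\<lambda>\<pi>. \<pi> + ?s) ` partitions (n - t r m)" by blast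
  next
    fix \<pi> assume "\<pi> \<in> (\<lambda>\<pi>. \<pi> + ?s) ` partitions (n - t r m)"
    then show "\<pi> \<in> {\<pi> \<in> partitions n. ?s \<subseteq># \<pi>}"
      using True by (auto simp: partitions_def sum_mset_staircase zero_notin_staircase)
  qed
  \<comment> \<open>Adding the fixed multiset \<open>?s\<close> is injective by cancellation, so the
    image keeps the cardinality.\<close>
  then have "card {\<pi> \<in> partitions n. ?s \<subseteq># \<pi>} = card (partitions (n - t r m))"
    by (simp add: card_image)
  then show ?thesis
    using True by (simp add: num_partitions_def staircase_subseteq_iff[OF assms] nat_diff_distrib)
next
  case False
  \<comment> \<open>Both sides vanish: the argument of \<open>num_partitions\<close> is negative,
    and the staircase alone outweighs \<open>n\<close>.\<close>
  have "t r m \<le> \<Sum>\<^sub># \<pi>" if "staircase r m \<subseteq># \<pi>" for \<pi>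
    using that by (auto simp: mset_subset_eq_exists_conv sum_mset_staircase)
  then have "\<not> m < rmex r \<pi>" if "\<pi> \<in> partitions n" for \<pi>
    using that False by (auto simp: partitions_def simp flip: staircase_subseteq_iff[OF assms])
  then have none: "{\<pi> \<in> partitions n. m < rmex r \<pi>} = {}" by blast
  show ?thesis
    using False unfolding none by (simp add: num_partitions_def)
qed

text \<open>After the exchange, \<open>f m\<close> is collected once per partition with
  \<open>r\<close>-mex above \<open>m\<close>. The semiring is left general because one identity
  lives in \<open>nat\<close> and the other in \<open>int\<close>.\<close>

lemma sum_partitions_lessThan_rmex:
  fixes f :: "nat \<Rightarrow> 'a::comm_semiring_1"
  assumes "0 < r"
  shows "(\<Sum>\<pi>\<in>partitions n. \<Sum>m<rmex r \<pi>. f m)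
    = (\<Sum>m. f m * of_nat (num_partitions (int n - int (t r m))))"
proof -
  let ?p = "\<lambda>m. num_partitions (int n - int (t r m))"
  \<comment> \<open>Any common bound on the \<open>r\<close>-mex over \<open>partitions n\<close>
    would do; it makes the range of \<open>m\<close> finite and independent of the partition, so
    that the sums can be swapped.\<close>
  define K where "K = (\<Sum>\<pi>\<in>partitions n. rmex r \<pi>)"
  have le: "rmex r \<pi> \<le> K" if "\<pi> \<in> partitions n" for \<pi>
    unfolding K_def using that finite_partitions by (intro member_le_sum) auto
  have "?p m = 0" if "K \<le> m" for m
    using le that by (fastforce simp: num_partitions_eq_card_rmex[OF assms] finite_partitions)
  then have "{m. f m * of_nat (?p m) \<noteq> 0} \<subseteq> {..<K}"
    by (force simp: not_less[symmetric])
  then have "(\<Sum>m. f m * of_nat (?p m)) = (\<Sum>m<K. f m * of_nat (?p m))"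
    by (intro Sum_any.expand_superset) auto
  also have "\<dots> = (\<Sum>m<K. \<Sum>\<pi>\<in>partitions n. if m < rmex r \<pi> then f m else 0)"
    by (simp add: num_partitions_eq_card_rmex[OF assms] sum.If_cases[OF finite_partitions]
        Int_def mult.commute)
  also have "\<dots> = (\<Sum>\<pi>\<in>partitions n. \<Sum>m<K. if m < rmex r \<pi> then f m else 0)"
    by (rule sum.swap)
  also have "\<dots> = (\<Sum>\<pi>\<in>partitions n. \<Sum>m<rmex r \<pi>. f m)"
    using le by (intro sum.cong[OF refl] sum.mono_neutral_cong_right) auto
  finally show ?thesis ..
qed

lemma sum_alternating_odd: "(\<Sum>m<k. (- 1) ^ m * (2 * int m + 1)) = (- 1) ^ (k - 1) * int k"
proof (induction k)
  case (Suc k)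
  \<comment> \<open>The new term turns \<open>-(-1)^k * k\<close> into
    \<open>(-1)^k * (k + 1)\<close>. The case \<open>k = 0\<close> is split off because
    \<open>k - 1\<close> is truncated there.\<close>
  then show ?case by (cases k) (simp_all add: algebra_simps)
qed simp

theorem corollary1p4:
  fixes r n :: nat
  assumes "1 \<le> r" and "1 \<le> n"
  shows "sigma_mex r n = (\<Sum>m. num_partitions (int n - int (t r m)))
    \<and> sigma_bar_mex r n = (\<Sum>m. (- 1) ^ m * (2 * int m + 1) * int (num_partitions (int n - int (t r m))))"
proof
  have r: "0 < r" using assms(1) by simp
  show "sigma_mex r n = (\<Sum>m. num_partitions (int n - int (t r m)))"
    using sum_partitions_lessThan_rmex[OF r, of "\<lambda>_. 1::nat" n] by (simp add: sigma_mex_def)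
  show "sigma_bar_mex r n
      = (\<Sum>m. (- 1) ^ m * (2 * int m + 1) * int (num_partitions (int n - int (t r m))))"
    using sum_partitions_lessThan_rmex[OF r, of "\<lambda>m. (- 1) ^ m * (2 * int m + 1)" n]
    by (simp add: sigma_bar_mex_def sum_alternating_odd)
qed

end
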